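(* Let $s \ge 2$ and let $\sigma$ be a string of length $n$ over $\Sigma = T \cup \bar{T}$ with $|T| = s$. Let $d$ be the minimum number of deletions needed to transform $\sigma$ into a string of $\mathrm{Dyck}(s)$. Then Random-deletion runs in linear time and, with constant probability, obtains a $2d$-approximation for edit distance with deletions only from $\sigma$ to $\mathrm{Dyck}(s)$ (i.e. the number of deletions it performs is within a factor $2d$ of the optimum number of deletions).
   Context: $T$ is a finite set of open parentheses; each $x \in T$ has a unique congruent close parenthesis $\bar{x}$, $\bar{T} = \{\bar{x} : x\in T\}$. $\mathrm{Dyck}(s)$ is the language of well-balanced strings over $T\cup\bar{T}$ generated by $S \to SS \mid \varepsilon \mid a S \bar{a}$ ($a \in T$). Random-deletion: initialize an empty stack and scan $\sigma$ left to right. If the current symbol is an open parenthesis, push it. If it is a close parenthesis: if the stack is empty, delete it; if the stack top is its matching open parenthesis, match (pop) them; otherwise delete either the stack top or the current symbol, each with probability $1/2$ independently. At the end of the scan, delete all symbols remaining in the stack. *)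

theory Defs
  imports "HOL-Probability.Probability"
begin

datatype 'a paren = is_open: Open (label: 'a) | Close (label: 'a)

definition alphabet :: "'a set \<Rightarrow> 'a paren set" where
  "alphabet T = Open ` T \<union> Close ` T"

inductive_set Dyck :: "'a set \<Rightarrow> 'a paren list set" for T :: "'a set" where
  concat: "u \<in> Dyck T \<Longrightarrow> v \<in> Dyck T \<Longrightarrow> u @ v \<in> Dyck T"
| empty: "[] \<in> Dyck T"
| wrap: "a \<in> T \<Longrightarrow> u \<in> Dyck T \<Longrightarrow> Open a # u @ [Close a] \<in> Dyck T"

definition delete_positions :: "nat set \<Rightarrow> 'b list \<Rightarrow> 'b list" where
  "delete_positions I w = nths w (- I)"

definition deletion_distance :: "'a set \<Rightarrow> 'a paren list \<Rightarrow> nat" where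
  "deletion_distance T \<sigma> =
     (LEAST k. \<exists>I \<subseteq> {..<length \<sigma>}. card I = k \<and> delete_positions I \<sigma> \<in> Dyck T)"

text \<open>
  The list \<open>D\<close> is the log of the performed deletions (as positions in \<open>\<sigma>\<close>), so the number of
  deletions is its length.
\<close>

definition deletion_approx :: "'a set \<Rightarrow> 'a paren list \<Rightarrow> nat \<Rightarrow> nat list \<Rightarrow> bool" where
  "deletion_approx T \<sigma> \<alpha> D \<longleftrightarrow>
     distinct D \<and> set D \<subseteq> {..<length \<sigma>} \<and> delete_positions (set D) \<sigma> \<in> Dyck T \<and>
     length D \<le> \<alpha> * deletion_distance T \<sigma>"

text \<open>
  A randomised computation is a distribution on pairs of a result and a number of elementary
  operations. \<open>v \<triangleright> k\<close> is a \<open>let\<close> that charges one time unit for computing \<open>v\<close>; below, \<open>v\<close> is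
  always a single unit-cost operation (emptiness test, reading the head, dropping the head, consing,
  comparing two symbols, testing whether a symbol is open, incrementing the position counter).
  A coin toss also costs one unit.
\<close>

definition tick :: "('r \<times> nat) pmf \<Rightarrow> ('r \<times> nat) pmf" where
  "tick m = map_pmf (\<lambda>(r, t). (r, Suc t)) m"

definition charged_let :: "'b \<Rightarrow> ('b \<Rightarrow> ('r \<times> nat) pmf) \<Rightarrow> ('r \<times> nat) pmf" (infixr \<open>\<triangleright>\<close> 20) where
  "(v \<triangleright> k) = tick (k v)"

definition toss :: "(bool \<Rightarrow> ('r \<times> nat) pmf) \<Rightarrow> ('r \<times> nat) pmf" where
  "toss k = tick (bind_pmf (bernoulli_pmf (1/2)) k)"

lemma charged_let_cong [fundef_cong]:
  "v = v' \<Longrightarrow> (\<And>x. x = v' \<Longrightarrow> k x = k' x) \<Longrightarrow> (v \<triangleright> k) = (v' \<triangleright> k')"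
  by (simp add: charged_let_def)

lemma toss_cong [fundef_cong]:
  "(\<And>b. k b = k' b) \<Longrightarrow> toss k = toss k'"
  by metis

function flush :: "(nat \<times> 'a paren) list \<Rightarrow> nat list \<Rightarrow> (nat list \<times> nat) pmf" where
  "flush st D =
     (st = [] \<triangleright> (\<lambda>stack_empty.
      if stack_empty then return_pmf (D, 0)
      else (hd st \<triangleright> (\<lambda>top.
            fst top # D \<triangleright> (\<lambda>D'.
            tl st \<triangleright> (\<lambda>st'.
            flush st' D'))))))"
  by pat_completeness auto
termination by (relation "measures [\<lambda>(st, D). length st]") auto

text \<open>
  Arguments of the scan: position of the current symbol, unread input (starting with the current
  symbol), stack of open parentheses tagged with their positions, deletions so far. If the stack top
  is deleted, the current symbol is not consumed and is treated again against the new stack.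
\<close>

function scan ::
  "nat \<Rightarrow> 'a paren list \<Rightarrow> (nat \<times> 'a paren) list \<Rightarrow> nat list \<Rightarrow> (nat list \<times> nat) pmf" where
  "scan i w st D =
     (w = [] \<triangleright> (\<lambda>at_end.
      if at_end then flush st D
      else
       (hd w \<triangleright> (\<lambda>c.
        is_open c \<triangleright> (\<lambda>opening.
        if opening then
          ((i, c) # st \<triangleright> (\<lambda>st'. tl w \<triangleright> (\<lambda>w'. Suc i \<triangleright> (\<lambda>i'. scan i' w' st' D))))
        else
         (st = [] \<triangleright> (\<lambda>stack_empty.
          if stack_empty then
            (i # D \<triangleright> (\<lambda>D'. tl w \<triangleright> (\<lambda>w'. Suc i \<triangleright> (\<lambda>i'. scan i' w' st D'))))
          else
           (hd st \<triangleright> (\<lambda>top.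
            snd top = Open (label c) \<triangleright> (\<lambda>matching.
            if matching then
              (tl st \<triangleright> (\<lambda>st'. tl w \<triangleright> (\<lambda>w'. Suc i \<triangleright> (\<lambda>i'. scan i' w' st' D))))
            else
              toss (\<lambda>delete_top.
                if delete_top then
                  (fst top # D \<triangleright> (\<lambda>D'. tl st \<triangleright> (\<lambda>st'. scan i w st' D')))
                else
                  (i # D \<triangleright> (\<lambda>D'. tl w \<triangleright> (\<lambda>w'. Suc i \<triangleright> (\<lambda>i'. scan i' w' st D')))))))))))))))"
  by pat_completeness auto
termination
  by (relation "measures [\<lambda>(i, w, st, D). length w, \<lambda>(i, w, st, D). length st]") auto

declare flush.simps [simp del] scan.simps [simp del]

definition random_deletion :: "'a paren list \<Rightarrow> (nat list \<times> nat) pmf" where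
  "random_deletion \<sigma> = ([] \<triangleright> (\<lambda>st. [] \<triangleright> (\<lambda>D. 0 \<triangleright> (\<lambda>i. scan i \<sigma> st D))))"

end

theory Submission
  imports Defs "HOL-Library.Sublist"
begin

text \<open>
  Let \<open>k\<close> be the deletion distance of the current stack followed by the unread input. Pushing does
  not change this string, matching does not increase \<open>k\<close>, and a forced deletion (of a closing
  parenthesis on the empty stack, or of the final stack) lowers it by one. At a mismatch every optimal
  solution deletes one of the two symbols, so at least one outcome of the coin lowers \<open>k\<close> by one, while
  the other raises it by at most one (delete also the partner of the wrongly deleted symbol). Hence the
  number of deletions is dominated by the time at which a simple symmetric random walk started at \<open>d\<close>
  hits \<open>0\<close>. By the reflection principle the probability of not hitting \<open>0\<close> up to time \<open>2 d\<^sup>2\<close> is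
  \<open>P(- d < S \<le> d)\<close>, where \<open>S\<close> is the walk from \<open>0\<close> at time \<open>2 d\<^sup>2\<close>; only \<open>d\<close> of these values have the
  right parity, so it is at most \<open>d\<close> times the central binomial probability, which is below \<open>3/4\<close>.
\<close>

section \<open>Dyck words and a stack acceptor\<close>

text \<open>Induction on the derivation: the split point falls into one factor of a concatenation,
  and at an end of a wrapped word the pair is simply concatenated.\<close>

lemma Dyck_insert_pair:
  assumes "u @ v \<in> Dyck T" "a \<in> T"
  shows "u @ Open a # Close a # v \<in> Dyck T"
  using assms(1)
proof (induction "u @ v" arbitrary: u v rule: Dyck.induct)
  case (concat x y)
  from concat(5) obtain z where "x = u @ z \<and> v = z @ y \<or> u = x @ z \<and> y = z @ v"
    by (auto simp: append_eq_append_conv2)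
  then show ?case
    using concat(2)[of u z] concat(4)[of z v] concat(1,3)
      Dyck.concat[of "u @ Open a # Close a # z" T y] Dyck.concat[of x T "z @ Open a # Close a # v"]
    by auto
next
  case empty
  then show ?case using Dyck.wrap[OF assms(2) Dyck.empty] by simp
next
  case (wrap b x)
  have pair: "[Open a, Close a] \<in> Dyck T"
    using Dyck.wrap[OF assms(2) Dyck.empty] by simp
  have whole: "Open b # x @ [Close b] \<in> Dyck T"
    using wrap(1,2) by (rule Dyck.wrap)
  show ?case
  proof (cases "u = [] \<or> v = []")
    case True
    then show ?thesis
      using wrap(4) Dyck.concat[OF pair whole] Dyck.concat[OF whole pair] by auto
  next
    case False
    then obtain u' v' where uv: "u = Open b # u'" "v = v' @ [Close b]" "x = u' @ v'"
      using wrap(4) by (cases u; cases v rule: rev_cases) auto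
    then show ?thesis using Dyck.wrap[OF wrap(1) wrap(3)[OF uv(3)]] by simp
  qed
qed

text \<open>The deterministic stack machine for \<open>Dyck T\<close>; unlike a derivation in the
  ambiguous grammar, its run is determined by the word. \<open>st\<close> holds the labels of the
  unmatched opening symbols, top first.\<close>

fun accepts :: "'a set \<Rightarrow> 'a list \<Rightarrow> 'a paren list \<Rightarrow> bool" where
  "accepts T st [] = (st = [])"
| "accepts T st (Open a # w) = (a \<in> T \<and> accepts T (a # st) w)"
| "accepts T [] (Close a # w) = False"
| "accepts T (b # st) (Close a # w) = (a = b \<and> accepts T st w)"

lemma accepts_Dyck_append: "u \<in> Dyck T \<Longrightarrow> accepts T st (u @ w) = accepts T st w"
  by (induction arbitrary: st w rule: Dyck.induct) auto

text \<open>A pop of the machine corresponds to inserting a pair at the border between the stack,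
  read from bottom to top, and the input.\<close>

lemma accepts_imp_Dyck:
  "set st \<subseteq> T \<Longrightarrow> accepts T st w \<Longrightarrow> map Open (rev st) @ w \<in> Dyck T"
proof (induction T st w rule: accepts.induct)
  case (4 T b st a w)
  then show ?case using Dyck_insert_pair[of "map Open (rev st)" w T b] by auto
qed (auto intro: Dyck.empty)

lemma Dyck_iff_accepts: "w \<in> Dyck T \<longleftrightarrow> accepts T [] w"
  using accepts_Dyck_append[of w T "[]" "[]"] accepts_imp_Dyck[of "[]" T w] by auto

lemma accepts_adjacent_pair:
  "accepts T st (u @ Open a # Close b # v) \<longleftrightarrow> a = b \<and> a \<in> T \<and> accepts T st (u @ v)"
  by (induction T st u rule: accepts.induct) auto

lemma Dyck_adjacent_pair:
  "u @ Open a # Close b # v \<in> Dyck T \<longleftrightarrow> a = b \<and> a \<in> T \<and> u @ v \<in> Dyck T"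
  by (simp add: Dyck_iff_accepts accepts_adjacent_pair)

lemma Close_Cons_notin_Dyck: "Close a # v \<notin> Dyck T"
  by (simp add: Dyck_iff_accepts)

lemma accepts_Opens: "accepts T st (map Open xs) \<Longrightarrow> xs = []"
proof (induction xs arbitrary: st)
  case (Cons x xs)
  then show ?case by (cases xs) auto
qed simp

lemma Dyck_Opens: "map Open xs \<in> Dyck T \<Longrightarrow> xs = []"
  by (auto simp: Dyck_iff_accepts dest: accepts_Opens)

text \<open>Besides \<open>x\<close>, the symbol paired with \<open>x\<close> in the derivation is
  removed; this is the price of a wrong deletion.\<close>

lemma Dyck_delete_partner:
  assumes "u @ x # v \<in> Dyck T"
  shows "\<exists>y\<in>Dyck T. subseq y (u @ v) \<and> Suc (length y) = length (u @ v)"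
  using assms
proof (induction "u @ x # v" arbitrary: u v rule: Dyck.induct)
  case (concat p q)
  from concat(5) consider z where "p = u @ x # z" "v = z @ q" | z where "u = p @ z" "q = z @ x # v"
    by (fastforce simp: append_eq_append_conv2 append_eq_Cons_conv)
  then show ?case
  proof cases
    case 1
    then obtain y where "y \<in> Dyck T" "subseq y (u @ z)" "Suc (length y) = length (u @ z)"
      using concat(2) by blast
    then show ?thesis using 1 concat(3)
      by (intro bexI[of _ "y @ q"]) (auto intro: Dyck.concat simp flip: append_assoc)
  next
    case 2
    then obtain y where "y \<in> Dyck T" "subseq y (z @ v)" "Suc (length y) = length (z @ v)"
      using concat(4) by blast
    then show ?thesis using 2 concat(1)
      by (intro bexI[of _ "p @ y"]) (auto intro: Dyck.concat simp: subseq_append')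
  qed
next
  case empty
  then show ?case by simp
next
  case (wrap b p)
  show ?case
  proof (cases "u = [] \<or> v = []")
    case True
    then show ?thesis using wrap(2,4) by (intro bexI[of _ p]) (auto simp: Cons_eq_append_conv)
  next
    case False
    then obtain u' v' where uv: "u = Open b # u'" "v = v' @ [Close b]" "p = u' @ x # v'"
      using wrap(4) by (cases u; cases v rule: rev_cases) auto
    then obtain y where y: "y \<in> Dyck T" "subseq y (u' @ v')" "Suc (length y) = length (u' @ v')"
      using wrap(3) by blast
    have "subseq (y @ [Close b]) ((u' @ v') @ [Close b])"
      using y(2) by (rule list_emb_append_mono) simp
    then show ?thesis using y uv wrap(1)
      by (intro bexI[of _ "Open b # y @ [Close b]"]) (auto intro: Dyck.wrap)
  qed
qed

section \<open>Deletion counts under the moves of the scan\<close>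

text \<open>Exactly \<open>k\<close> deletions, not necessarily a minimal number.\<close>

definition edit :: "'a set \<Rightarrow> nat \<Rightarrow> 'a paren list \<Rightarrow> bool" where
  "edit T k w \<longleftrightarrow> (\<exists>y\<in>Dyck T. subseq y w \<and> length y + k = length w)"

lemma editE:
  assumes "edit T k (u @ v)"
  obtains p q where "p @ q \<in> Dyck T" "subseq p u" "subseq q v"
    "length p + length q + k = length u + length v"
  using assms unfolding edit_def by (force elim!: subseq_appendE)

text \<open>\<open>p @ q\<close> is what an old solution keeps of the new string; \<open>y\<close>
  may be smaller because a partner is dropped as well.\<close>

lemma editI:
  assumes "y \<in> Dyck T" "subseq y (p @ q)" "subseq p u" "subseq q v"
    "length y + k = length u + length v"
  shows "edit T k (u @ v)"
proof -
  have "subseq (p @ q) (u @ v)" using assms(3,4) by (rule list_emb_append_mono)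
  then have "subseq y (u @ v)" using assms(2) subseq_order.order_trans by blast
  then show ?thesis using assms(1,5) unfolding edit_def by auto
qed

lemma subseq_ConsE:
  assumes "subseq q (x # v)"
  obtains "subseq q v" | q' where "q = x # q'" "subseq q' v"
  using assms by (cases rule: list_emb.cases) auto

text \<open>If the solution deletes \<open>x\<close>, one deletion is saved; if it keeps
  \<open>x\<close>, the partner of \<open>x\<close> is deleted too, which costs one more.\<close>

lemma edit_delete:
  assumes "edit T k (u @ x # v)"
  shows "edit T (Suc k) (u @ v) \<or> (\<exists>k'. k = Suc k' \<and> edit T k' (u @ v))"
proof -
  from assms obtain p q where pq: "p @ q \<in> Dyck T" "subseq p u" "subseq q (x # v)"
    "length p + length q + k = length u + length (x # v)"
    by (rule editE)
  from pq(3) show ?thesis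
  proof (cases rule: subseq_ConsE)
    case 1
    have "length p \<le> length u" "length q \<le> length v"
      using pq(2) 1 by (auto dest: list_emb_length)
    then obtain k' where "k = Suc k'" using pq(4) by (cases k) auto
    then show ?thesis using pq 1 by (auto intro!: editI[of "p @ q" T p q])
  next
    case (2 q')
    then obtain y where "y \<in> Dyck T" "subseq y (p @ q')" "Suc (length y) = length (p @ q')"
      using pq(1) Dyck_delete_partner by blast
    then show ?thesis using pq 2 by (auto intro!: editI[of y T p q'])
  qed
qed

text \<open>If both symbols are kept, they match each other. If one is kept, the deletion of the
  other is traded for that of the partner. If none is kept, two deletions are saved.\<close>

lemma edit_match:
  assumes "edit T k (u @ Open a # Close a # v)"
  shows "\<exists>k'\<le>k. edit T k' (u @ v)"
proof -
  from assms obtain p q where pq: "p @ q \<in> Dyck T" "subseq p u" "subseq q (Open a # Close a # v)"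
    "length p + length q + k = length u + length (Open a # Close a # v)"
    by (rule editE)
  have one_kept: ?thesis if q: "q = c # q'" "subseq q' v" for c q'
  proof -
    obtain y where "y \<in> Dyck T" "subseq y (p @ q')" "Suc (length y) = length (p @ q')"
      using pq(1) q(1) Dyck_delete_partner by blast
    then have "edit T k (u @ v)" using pq q by (intro editI[of y T p q']) auto
    then show ?thesis by blast
  qed
  from pq(3) show ?thesis
  proof (cases rule: subseq_ConsE)
    case 1
    from 1 show ?thesis
    proof (cases rule: subseq_ConsE)
      case 1
      have "length p \<le> length u" "length q \<le> length v"
        using pq(2) 1 by (auto dest: list_emb_length)
      \<comment> \<open>The length bounds force \<open>k\<close> to be at least 2, so the
        subtraction is not truncated.\<close>
      then have "edit T (k - 2) (u @ v)" using pq 1 by (intro editI[of "p @ q" T p q]) auto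
      then show ?thesis by (meson diff_le_self)
    qed (rule one_kept)
  next
    case (2 q')
    from 2(2) show ?thesis
    proof (cases rule: subseq_ConsE)
      case 1
      then show ?thesis using one_kept 2(1) by blast
    next
      case (2 q'')
      then have "p @ q'' \<in> Dyck T"
        using pq(1) \<open>q = Open a # q'\<close> by (simp add: Dyck_adjacent_pair)
      then have "edit T k (u @ v)"
        using pq 2 \<open>q = Open a # q'\<close> by (intro editI[of "p @ q''" T p q'']) auto
      then show ?thesis by blast
    qed
  qed
qed

text \<open>Keeping both symbols would leave an adjacent pair with different labels in a Dyck word,
  so one of the two is deleted.\<close>

lemma edit_mismatch:
  assumes "edit T k (u @ Open a # Close b # v)" "a \<noteq> b"
  shows "\<exists>k'. k = Suc k' \<and> (edit T k' (u @ Open a # v) \<or> edit T k' (u @ Close b # v))"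
proof -
  from assms obtain p q where pq: "p @ q \<in> Dyck T" "subseq p u" "subseq q (Open a # Close b # v)"
    "length p + length q + k = length u + length (Open a # Close b # v)"
    by (auto elim: editE)
  have *: "subseq q (Close b # v) \<or> subseq q (Open a # v)"
    using pq(3)
  proof (cases rule: subseq_ConsE)
    case (2 q')
    from 2(2) show ?thesis
    proof (cases rule: subseq_ConsE)
      case (2 q'')
      then show ?thesis
        using pq(1) \<open>q = Open a # q'\<close> \<open>a \<noteq> b\<close> by (simp add: Dyck_adjacent_pair)
    qed (use 2(1) in simp)
  qed simp
  then have "length p + length q \<le> length u + Suc (length v)"
    using pq(2) by (auto dest!: list_emb_length)
  then obtain k' where "k = Suc k'" using pq(4) by (cases k) auto
  with * show ?thesis using pq by (auto intro!: editI[of "p @ q" T p q])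
qed

lemma edit_Close_Cons:
  assumes "edit T k (Close b # v)"
  shows "\<exists>k'. k = Suc k' \<and> edit T k' v"
proof -
  from assms obtain y where y: "y \<in> Dyck T" "subseq y (Close b # v)"
    "length y + k = Suc (length v)"
    unfolding edit_def by auto
  from y(2) have "subseq y v"
  proof (cases rule: subseq_ConsE)
    case (2 q')
    then show ?thesis using y(1) Close_Cons_notin_Dyck[of b q' T] by blast
  qed
  moreover from this have "length y \<le> length v" by (rule list_emb_length)
  ultimately show ?thesis using y unfolding edit_def by (cases k) auto
qed

lemma edit_Opens:
  assumes "edit T k (map Open xs)"
  shows "k = length xs"
proof -
  from assms obtain y where y: "y \<in> Dyck T" "subseq y (map Open xs)" "length y + k = length xs"
    unfolding edit_def by auto
  from y(2) obtain N where "y = map Open (nths xs N)"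
    by (auto simp: subseq_conv_nths nths_map)
  then have "y = []" using y(1) Dyck_Opens by auto
  then show ?thesis using y(3) by simp
qed

text \<open>The \<open>LEAST\<close> is attained because deleting all positions leaves the empty
  word.\<close>

lemma edit_deletion_distance: "edit T (deletion_distance T \<sigma>) \<sigma>"
proof -
  have "delete_positions {..<length \<sigma>} \<sigma> = []"
    by (auto simp: delete_positions_def length_nths simp flip: length_0_conv)
  then have "\<exists>k. \<exists>I\<subseteq>{..<length \<sigma>}. card I = k \<and> delete_positions I \<sigma> \<in> Dyck T"
    using Dyck.empty by (intro exI[of _ "card {..<length \<sigma>}"] exI[of _ "{..<length \<sigma>}"]) simp
  then obtain I where I: "I \<subseteq> {..<length \<sigma>}" "card I = deletion_distance T \<sigma>"
    "delete_positions I \<sigma> \<in> Dyck T"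
    using LeastI_ex[of "\<lambda>k. \<exists>I\<subseteq>{..<length \<sigma>}. card I = k \<and> delete_positions I \<sigma> \<in> Dyck T"]
    unfolding deletion_distance_def by blast
  have "{i. i < length \<sigma> \<and> i \<in> - I} = {..<length \<sigma>} - I" by auto
  then have "length (delete_positions I \<sigma>) = length \<sigma> - card I"
    using I(1) by (simp add: delete_positions_def length_nths card_Diff_subset finite_subset)
  moreover have "card I \<le> length \<sigma>" using I(1) card_mono[of "{..<length \<sigma>}" I] by simp
  ultimately show ?thesis using I(2,3) unfolding edit_def
    by (intro bexI[of _ "delete_positions I \<sigma>"])
      (auto simp: delete_positions_def subseq_conv_nths)
qed

section \<open>The simple symmetric random walk and its hitting time\<close>

text \<open>Probability that the simple symmetric walk started at \<open>k\<close> hits \<open>0\<close> within \<open>t\<close> steps.\<close>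

fun hit :: "nat \<Rightarrow> nat \<Rightarrow> real" where
  "hit 0 t = 1"
| "hit (Suc k) 0 = 0"
| "hit (Suc k) (Suc t) = (hit k t + hit (Suc (Suc k)) t) / 2"

lemma hit_nonneg: "0 \<le> hit k t"
  by (induction k t rule: hit.induct) auto

lemma hit_le_1: "hit k t \<le> 1"
  by (induction k t rule: hit.induct) auto

text \<open>Allows the deletion distance to fall faster than the walk does; at the barrier the bound
  by 1 takes over.\<close>

lemma hit_Suc_le: "hit (Suc k) t \<le> hit k t"
proof (induction t arbitrary: k)
  case 0
  then show ?case by (simp add: hit_nonneg)
next
  case (Suc t)
  show ?case
  proof (cases k)
    case 0
    then show ?thesis by (simp only: hit.simps(1) hit_le_1)
  next
    case (Suc j)
    then show ?thesis using Suc.IH[of j] Suc.IH[of "Suc (Suc j)"] by simp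
  qed
qed

lemma hit_antimono: "k \<le> k' \<Longrightarrow> hit k' t \<le> hit k t"
  using lift_Suc_antimono_le[of "\<lambda>k. hit k t"] hit_Suc_le by blast

lemma hit_eq_0: "t < k \<Longrightarrow> hit k t = 0"
  by (induction k t rule: hit.induct) auto

text \<open>Probability that the simple symmetric walk started at \<open>0\<close> is at \<open>x\<close> after \<open>t\<close> steps.\<close>

definition walk :: "nat \<Rightarrow> int \<Rightarrow> real" where
  "walk t x = (if even (int t + x) \<and> 0 \<le> int t + x
     then real (t choose nat ((int t + x) div 2)) / 2 ^ t else 0)"

lemma walk_0: "walk 0 x = (if x = 0 then 1 else 0)"
proof (cases "even x \<and> x > 0")
  case True
  then have "nat (x div 2) \<noteq> 0" by auto
  then have "0 choose nat (x div 2) = 0" by (simp add: binomial_eq_0)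
  then show ?thesis using True by (auto simp: walk_def)
qed (auto simp: walk_def)

text \<open>Pascal's rule for \<open>j\<close> up-steps; \<open>j = 0\<close> is the leftmost
  position, reached by down-steps only.\<close>

lemma walk_Suc: "walk (Suc t) x = (walk t (x - 1) + walk t (x + 1)) / 2"
proof (cases "even (int (Suc t) + x) \<and> 0 \<le> int (Suc t) + x")
  case True
  then obtain j where "int (Suc t) + x = 2 * int j"
    by (metis evenE zero_le_imp_eq_int zero_le_mult_iff zero_less_numeral not_less)
  then have x: "x = 2 * int j - int t - 1" by simp
  show ?thesis
  proof (cases j)
    case 0
    then show ?thesis by (simp add: walk_def x)
  next
    case (Suc i)
    have "(2 + 2 * int i) div 2 = int (Suc i)" by simp
    then show ?thesis using Suc by (simp add: walk_def x field_simps nat_add_distrib)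
  qed
next
  case False
  then have "walk (Suc t) x = 0" unfolding walk_def by (rule if_not_P)
  moreover have "walk t (x - 1) = 0" "walk t (x + 1) = 0"
    using False by (auto simp: walk_def)
  ultimately show ?thesis by simp
qed

text \<open>The reflection principle, proved by checking that both sides satisfy the same recursion.\<close>

lemma one_minus_hit: "1 - hit k t = (\<Sum>x\<in>{- int k<..int k}. walk t x)"
proof (induction t arbitrary: k)
  case 0
  then show ?case by (cases k) (auto simp: walk_0 sum.delta)
next
  case (Suc t)
  show ?case
  proof (cases k)
    case 0
    then show ?thesis by simp
  next
    case (Suc j)
    let ?j = "int j" and ?S = "sum (walk t)"
    have shift: "(\<Sum>x\<in>{a<..b}. walk t (x + c)) = ?S {a + c<..b + c}" for a b c
      by (rule sum.reindex_bij_witness[of _ "\<lambda>x. x - c" "\<lambda>x. x + c"]) auto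
    have bounds: "- int k - 1 = - ?j - 2" "int k - 1 = ?j" "1 - int k = - ?j" "int k + 1 = ?j + 2"
      using Suc by simp_all
    have split: "?S {a<..c} = ?S {a<..b} + ?S {b<..c}" if "a \<le> b" "b \<le> c" for a b c
      using that by (subst sum.union_disjoint[symmetric]) (auto simp: ivl_disj_un)
    have "(\<Sum>x\<in>{- int k<..int k}. walk (Suc t) x) =
        (?S {- ?j - 2<..?j} + ?S {- ?j<..?j + 2}) / 2"
      using shift[where a = "- int k" and b = "int k" and c = "- 1"]
        shift[where a = "- int k" and b = "int k" and c = 1]
      by (simp add: walk_Suc sum.distrib bounds flip: sum_divide_distrib)
    \<comment> \<open>The two shifted windows are regrouped into the windows of the induction
      hypothesis for \<open>j\<close> and \<open>j + 2\<close>.\<close>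
    also have "\<dots> = (?S {- ?j<..?j} + ?S {- ?j - 2<..?j + 2}) / 2"
      using split[of "- ?j - 2" ?j "?j + 2"] split[of "- ?j" ?j "?j + 2"] by simp
    also have "\<dots> = (1 - hit j t + (1 - hit (Suc (Suc j)) t)) / 2"
      by (simp add: Suc.IH algebra_simps)
    finally show ?thesis using Suc by (simp add: field_simps)
  qed
qed

text \<open>Parity excludes odd positions after an even number of steps, and the central coefficient
  is the largest.\<close>

lemma walk_le_central: "walk (2 * m) x \<le> (if even x then real (2 * m choose m) / 4 ^ m else 0)"
  using binomial_maximum'[of m] by (auto simp: walk_def power_mult divide_right_mono)

text \<open>The induction step adds the points \<open>- k\<close> and \<open>k + 1\<close>, exactly
  one of which is even.\<close>

lemma sum_even_interval: "(\<Sum>x\<in>{- int k<..int k}. if even x then B else 0) = real k * (B::real)"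
proof (induction k)
  case (Suc k)
  have "{- int (Suc k)<..int (Suc k)} = insert (- int k) (insert (int (Suc k)) {- int k<..int k})"
    by auto
  then show ?case using Suc by (auto simp: algebra_simps)
qed simp

text \<open>A square-root-free form of the bound 1 / sqrt (2m + 1) on the central probability.
  Consecutive central coefficients have ratio 2(2m + 1) / (m + 1), and (2m + 1)(2m + 3) is below (2m
  + 2) squared.\<close>

lemma central_binomial_upper_bound: "(2 * m + 1) * (2 * m choose m)\<^sup>2 \<le> 16 ^ m"
proof (induction m)
  case (Suc m)
  define c c' where "c = 2 * m choose m" and "c' = 2 * Suc m choose Suc m"
  have "Suc m * c' = (2 * m + 2) * (Suc (2 * m) choose m)"
    using Suc_times_binomial_eq[of "Suc (2 * m)" m] by (simp add: c'_def)
  moreover have "Suc m * (Suc (2 * m) choose m) = (2 * m + 1) * c"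
    using Suc_times_binomial_eq[of "2 * m" m] binomial_symmetric[of m "Suc (2 * m)"]
    by (simp add: c_def)
  moreover from calculation(1) have "Suc m * c' = Suc m * (2 * (Suc (2 * m) choose m))" by simp
  then have "c' = 2 * (Suc (2 * m) choose m)" by (simp only: mult_cancel1 nat.distinct simp_thms)
  ultimately have step: "Suc m * c' = 2 * (2 * m + 1) * c" by (simp del: binomial_Suc_Suc)
  have "(Suc m)\<^sup>2 * ((2 * Suc m + 1) * c'\<^sup>2) = (2 * m + 3) * (Suc m * c')\<^sup>2"
    by (simp add: power2_eq_square algebra_simps)
  also have "\<dots> = 4 * ((2 * m + 3) * (2 * m + 1)) * ((2 * m + 1) * c\<^sup>2)"
    unfolding step by (simp add: power2_eq_square algebra_simps)
  also have "\<dots> \<le> 4 * (4 * (Suc m)\<^sup>2) * 16 ^ m"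
  proof (rule mult_le_mono)
    show "4 * ((2 * m + 3) * (2 * m + 1)) \<le> 4 * (4 * (Suc m)\<^sup>2)"
      by (simp add: power2_eq_square algebra_simps)
    show "(2 * m + 1) * c\<^sup>2 \<le> 16 ^ m" using Suc unfolding c_def .
  qed
  also have "\<dots> = (Suc m)\<^sup>2 * 16 ^ Suc m" by simp
  finally have "(2 * Suc m + 1) * c'\<^sup>2 \<le> 16 ^ Suc m" by (rule mult_left_le_imp_le) simp
  then show ?case unfolding c'_def .
qed simp

lemma hit_lower_bound: "1 / 4 \<le> hit d (2 * d * d)"
proof (cases "d = 0")
  case False
  define B where "B = real (2 * d\<^sup>2 choose d\<^sup>2) / 4 ^ d\<^sup>2"
  have t: "2 * d * d = 2 * d\<^sup>2" by (simp add: power2_eq_square)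
  have "1 - hit d (2 * d\<^sup>2) \<le> (\<Sum>x\<in>{- int d<..int d}. if even x then B else 0)"
    unfolding one_minus_hit B_def by (intro sum_mono walk_le_central)
  then have le: "1 - hit d (2 * d\<^sup>2) \<le> real d * B" by (simp add: sum_even_interval)
  have "real ((2 * d\<^sup>2 + 1) * (2 * d\<^sup>2 choose d\<^sup>2)\<^sup>2) \<le> real (16 ^ d\<^sup>2)"
    using central_binomial_upper_bound by (rule of_nat_mono)
  then have "(2 * (real d)\<^sup>2 + 1) * (real (2 * d\<^sup>2 choose d\<^sup>2))\<^sup>2 \<le> 16 ^ d\<^sup>2"
    by (simp only: of_nat_mult of_nat_add of_nat_power of_nat_numeral of_nat_1)
  moreover have "(4 ^ d\<^sup>2)\<^sup>2 = (16::real) ^ d\<^sup>2"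
    by (simp add: power2_eq_square flip: power_mult_distrib)
  ultimately have "(2 * (real d)\<^sup>2 + 1) * B\<^sup>2 \<le> 1"
    by (simp add: B_def power_divide)
  then have "2 * (real d * B)\<^sup>2 \<le> 1"
    by (simp add: algebra_simps power_mult_distrib) (smt (verit) zero_le_power2)
  \<comment> \<open>So \<open>d * B\<close> is at most 1 / sqrt 2; the rational bound 3/4 works
    since 1/2 < 9/16.\<close>
  then have "(real d * B)\<^sup>2 \<le> (3 / 4)\<^sup>2" by (simp add: power2_eq_square)
  then have "real d * B \<le> 3 / 4" by (rule power2_le_imp_le) simp
  then show ?thesis using le unfolding t by simp
qed simp

section \<open>Step equations of the program and its running time\<close>

lemma map_fst_ticks [simp]: "map_pmf fst ((tick ^^ n) m) = map_pmf fst m"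
  by (induction n) (simp_all add: tick_def map_pmf_comp case_prod_unfold)

lemma set_ticks: "set_pmf ((tick ^^ n) m) = (\<lambda>x. (fst x, snd x + n)) ` set_pmf m"
  by (induction n) (simp_all add: tick_def image_image case_prod_unfold)

lemma flush_Nil: "flush [] D = (tick ^^ 1) (return_pmf (D, 0))"
  by (subst flush.simps) (simp add: charged_let_def)

lemma flush_Cons: "flush (e # st) D = (tick ^^ 4) (flush st (fst e # D))"
  by (subst flush.simps) (simp add: charged_let_def eval_nat_numeral)

lemma scan_Nil: "scan i [] st D = (tick ^^ 1) (flush st D)"
  by (subst scan.simps) (simp add: charged_let_def)

lemma scan_Open:
  "scan i (Open a # w) st D = (tick ^^ 6) (scan (Suc i) w ((i, Open a) # st) D)"
  by (subst scan.simps) (simp add: charged_let_def eval_nat_numeral)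

lemma scan_Close_Nil:
  "scan i (Close a # w) [] D = (tick ^^ 7) (scan (Suc i) w [] (i # D))"
  by (subst scan.simps) (simp add: charged_let_def eval_nat_numeral)

lemma scan_match:
  "scan i (Close a # w) ((j, Open a) # st) D = (tick ^^ 9) (scan (Suc i) w st D)"
  by (subst scan.simps) (simp add: charged_let_def eval_nat_numeral)

lemma scan_mismatch:
  assumes "x \<noteq> Open a"
  shows "scan i (Close a # w) ((j, x) # st) D = (tick ^^ 7) (bind_pmf (bernoulli_pmf (1/2)) (\<lambda>b.
    if b then (tick ^^ 2) (scan i (Close a # w) st (j # D))
    else (tick ^^ 3) (scan (Suc i) w ((j, x) # st) (i # D))))"
  by (subst scan.simps) (simp add: assms charged_let_def toss_def eval_nat_numeral cong: if_cong)

text \<open>One case per branch of the scan. The measure 2|w| + |st| drops even when a push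
  lengthens the stack or a deleted top leaves the input unchanged.\<close>

lemma scan_state_induct [case_names Nil Open Close_Nil match mismatch]:
  fixes P :: "nat \<Rightarrow> 'a paren list \<Rightarrow> (nat \<times> 'a paren) list \<Rightarrow> nat list \<Rightarrow> bool"
  assumes "\<And>i st D. P i [] st D"
    and "\<And>i a w st D. P (Suc i) w ((i, Open a) # st) D \<Longrightarrow> P i (Open a # w) st D"
    and "\<And>i a w D. P (Suc i) w [] (i # D) \<Longrightarrow> P i (Close a # w) [] D"
    and "\<And>i a w j st D. P (Suc i) w st D \<Longrightarrow> P i (Close a # w) ((j, Open a) # st) D"
    and "\<And>i a w j x st D. x \<noteq> Open a \<Longrightarrow> P i (Close a # w) st (j # D) \<Longrightarrow>
      P (Suc i) w ((j, x) # st) (i # D) \<Longrightarrow> P i (Close a # w) ((j, x) # st) D"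
  shows "P i w st D"
proof (induction "2 * length w + length st" arbitrary: i w st D rule: less_induct)
  case less
  show ?case
  proof (cases w)
    case Nil
    then show ?thesis using assms(1) by simp
  next
    case (Cons c w')
    show ?thesis
    proof (cases c)
      case (Open a)
      then show ?thesis using Cons less by (auto intro!: assms(2))
    next
      case (Close a)
      show ?thesis
      proof (cases st)
        case Nil
        then show ?thesis using Cons Close less by (auto intro!: assms(3))
      next
        case (Cons e st')
        obtain j x where e: "e = (j, x)" by (cases e)
        show ?thesis
        proof (cases "x = Open a")
          case True
          then show ?thesis using Cons e Close \<open>w = c # w'\<close> less by (auto intro!: assms(4))
        next
          case False
          then show ?thesis using Cons e Close \<open>w = c # w'\<close> less by (auto intro!: assms(5))
        qed
      qed
    qed
  qed
qed

lemma set_fair_bind: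
  "set_pmf (bind_pmf (bernoulli_pmf (1/2)) (\<lambda>b. if b then M else N)) = set_pmf M \<union> set_pmf N"
  by (auto simp: UNIV_bool)

lemma flush_time: "\<forall>x\<in>set_pmf (flush st D). snd x \<le> 4 * length st + 1"
  by (induction st arbitrary: D) (simp_all add: flush_Nil flush_Cons set_ticks tick_def)

text \<open>Each branch costs at most 10 and lowers 2|w| + |st| by at least one; the rate 13 also
  covers the flush at 4 per stack entry. The summand 2 pays for the last two emptiness
  tests.\<close>

lemma scan_time: "\<forall>x\<in>set_pmf (scan i w st D). snd x \<le> 13 * (2 * length w + length st) + 2"
proof (induction i w st D rule: scan_state_induct)
  case (Nil i st D)
  show ?case using flush_time[of st D] unfolding scan_Nil set_ticks by fastforce
next
  case (Open i a w st D)
  then show ?case unfolding scan_Open set_ticks by fastforce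
next
  case (Close_Nil i a w D)
  then show ?case unfolding scan_Close_Nil set_ticks by fastforce
next
  case (match i a w j st D)
  then show ?case unfolding scan_match set_ticks by fastforce
next
  case (mismatch i a w j x st D)
  then show ?case unfolding scan_mismatch[OF mismatch(1)] set_ticks set_fair_bind by fastforce
qed

section \<open>Domination of the number of deletions by the walk\<close>

lemma flush_result: "map_pmf fst (flush st D) = return_pmf (rev (map fst st) @ D)"
  by (induction st arbitrary: D) (simp_all add: flush_Nil flush_Cons del: funpow.simps)

lemma map_fst_scan_mismatch:
  assumes "x \<noteq> Open a"
  shows "map_pmf fst (scan i (Close a # w) ((j, x) # st) D) = bind_pmf (bernoulli_pmf (1/2)) (\<lambda>b.
    if b then map_pmf fst (scan i (Close a # w) st (j # D))
    else map_pmf fst (scan (Suc i) w ((j, x) # st) (i # D)))"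
  unfolding scan_mismatch[OF assms] map_fst_ticks map_bind_pmf
  by (intro bind_pmf_cong) (simp_all del: funpow.simps)

lemma prob_fair_bind:
  "measure_pmf.prob (bind_pmf (bernoulli_pmf (1/2)) (\<lambda>b. if b then M else N)) A =
    (measure_pmf.prob M A + measure_pmf.prob N A) / 2"
proof -
  have "ennreal (measure_pmf.prob (bind_pmf (bernoulli_pmf (1/2)) (\<lambda>b. if b then M else N)) A) =
    ennreal ((measure_pmf.prob M A + measure_pmf.prob N A) / 2)"
    by (simp flip: measure_pmf.emeasure_eq_measure)
      (simp add: measure_pmf.emeasure_eq_measure add_divide_distrib divide_ennreal_def
        flip: ennreal_divide_numeral)
  then show ?thesis by (subst (asm) ennreal_inj) auto
qed

text \<open>Induction over the run replaces an explicit coupling with the walk. The stack is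
  reversed because its head is the symbol next to the unread input.\<close>

lemma prob_few_deletions:
  assumes "edit T k (map snd (rev st) @ w)" "snd ` set st \<subseteq> range Open"
  shows "hit k t \<le> measure_pmf.prob (map_pmf fst (scan i w st D)) {E. length E \<le> length D + t}"
  using assms
proof (induction i w st D arbitrary: k t rule: scan_state_induct)
  case (Nil i st D)
  have "map snd (rev st) = map Open (map (label \<circ> snd) (rev st))" using Nil(2) by force
  then have "k = length st"
    using Nil(1) edit_Opens[of T k "map (label \<circ> snd) (rev st)"]
    by (metis append_Nil2 length_map length_rev)
  \<comment> \<open>The flush deletes exactly \<open>k\<close> symbols; for \<open>t < k\<close> the
    walk cannot have reached 0.\<close>
  then show ?case
    by (cases "k \<le> t") (simp_all add: scan_Nil flush_result hit_le_1 hit_eq_0 del: funpow.simps)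
next
  case (Open i a w st D)
  then show ?case by (simp add: scan_Open del: funpow.simps)
next
  case (Close_Nil i a w D)
  from Close_Nil(2) obtain k' where k': "k = Suc k'" "edit T k' w"
    using edit_Close_Cons[of T k a w] by auto
  show ?case
  proof (cases t)
    case 0
    then show ?thesis using k' by simp
  next
    case (Suc t')
    \<comment> \<open>A certain drop to \<open>k'\<close> is at least as good as the average over
      \<open>k'\<close> and \<open>k' + 2\<close>.\<close>
    have "hit k t \<le> hit k' t'"
      using Suc k' hit_antimono[of k' "Suc (Suc k')" t'] by simp
    also have "\<dots> \<le> measure_pmf.prob (map_pmf fst (scan (Suc i) w [] (i # D)))
        {E. length E \<le> length (i # D) + t'}"
      using k' by (intro Close_Nil(1)) auto
    finally show ?thesis using Suc by (simp add: scan_Close_Nil del: funpow.simps)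
  qed
next
  case (match i a w j st D)
  then obtain k' where k': "k' \<le> k" "edit T k' (map snd (rev st) @ w)"
    using edit_match[of T k "map snd (rev st)" a w] by auto
  have "hit k t \<le> hit k' t" using k'(1) by (rule hit_antimono)
  also have "\<dots> \<le> measure_pmf.prob (map_pmf fst (scan (Suc i) w st D))
      {E. length E \<le> length D + t}"
    using k' match(3) by (intro match(1)) auto
  finally show ?case by (simp add: scan_match del: funpow.simps)
next
  case (mismatch i a w j x st D)
  let ?u = "map snd (rev st)"
  obtain b where x: "x = Open b" "b \<noteq> a" using mismatch(1,5) by auto
  have edit: "edit T k (?u @ Open b # Close a # w)" using mismatch(4) x by simp
  obtain k' where k: "k = Suc k'"
    and good: "edit T k' (?u @ Open b # w) \<or> edit T k' (?u @ Close a # w)"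
    using edit_mismatch[OF edit x(2)] by auto
  \<comment> \<open>Either outcome of the coin leads to \<open>Suc k\<close> or to
    \<open>k'\<close>; by \<open>good\<close>, at least one leads to \<open>k'\<close>.\<close>
  have top: "edit T (Suc k) (?u @ Close a # w) \<or> edit T k' (?u @ Close a # w)"
    using edit_delete[OF edit] k by auto
  have cur: "edit T (Suc k) (?u @ Open b # w) \<or> edit T k' (?u @ Open b # w)"
    using edit_delete[of T k "?u @ [Open b]" "Close a" w] edit k by auto
  show ?case
  proof (cases t)
    case 0
    then show ?thesis using k by simp
  next
    case (Suc t')
    define P where "P = measure_pmf.prob (map_pmf fst (scan i (Close a # w) st (j # D)))
      {E. length E \<le> length D + t}"
    define Q where "Q = measure_pmf.prob (map_pmf fst (scan (Suc i) w ((j, x) # st) (i # D)))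
      {E. length E \<le> length D + t}"
    have P: "hit l t' \<le> P" if "edit T l (?u @ Close a # w)" for l
      using mismatch(2)[OF that, of t'] mismatch(5) Suc by (simp add: P_def)
    have Q: "hit l t' \<le> Q" if "edit T l (?u @ Open b # w)" for l
      using mismatch(3)[of l t'] that mismatch(5) Suc x by (simp add: Q_def)
    \<comment> \<open>Covers the case that both outcomes lower the distance.\<close>
    have "hit (Suc k) t' \<le> hit k' t'" using k by (intro hit_antimono) simp
    then have "hit k' t' + hit (Suc k) t' \<le> P + Q"
      using good top cur P Q by fastforce
    then show ?thesis
      unfolding map_fst_scan_mismatch[OF mismatch(1)] prob_fair_bind P_def[symmetric] Q_def[symmetric]
      using k Suc by simp
  qed
qed

section \<open>Correctness of the deletion log\<close>

text \<open>The analogue of \<open>delete_positions\<close> for entries that carry their own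
  position, since the stack need not be a contiguous piece of the input.\<close>

definition kept :: "nat set \<Rightarrow> (nat \<times> 'b) list \<Rightarrow> 'b list" where
  "kept I xs = map snd (filter (\<lambda>e. fst e \<notin> I) xs)"

lemma kept_simps [simp]:
  "kept I [] = []"
  "kept I (e # xs) = (if fst e \<in> I then kept I xs else snd e # kept I xs)"
  "kept I (xs @ ys) = kept I xs @ kept I ys"
  by (auto simp: kept_def)

lemma kept_insert: "j \<notin> fst ` set xs \<Longrightarrow> kept (insert j I) xs = kept I xs"
  by (induction xs) auto

lemma kept_enumerate: "kept I (List.enumerate i w) = nths w {p. p + i \<notin> I}"
  by (induction w arbitrary: i) (auto simp: nths_Cons)

lemma fst_set_enumerate: "fst ` set (List.enumerate i w) = {i..<i + length w}"
  by (metis map_fst_enumerate set_map set_upt)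

text \<open>\<open>F\<close> is what the rest of the run adds to the log. Stack positions are
  distinct and lie below \<open>i\<close>, so nothing is logged twice.\<close>

lemma scan_result_Dyck:
  assumes "E \<in> set_pmf (map_pmf fst (scan i w st D))"
    "distinct (map fst st)" "fst ` set st \<subseteq> {..<i}" "snd ` set st \<subseteq> Open ` T"
    "w \<in> lists (alphabet T)"
  shows "\<exists>F. E = F @ D \<and> distinct F \<and> set F \<subseteq> fst ` set st \<union> {i..<i + length w} \<and>
    kept (set F) (rev st @ List.enumerate i w) \<in> Dyck T"
  using assms
proof (induction i w st D rule: scan_state_induct)
  case (Nil i st D)
  have "kept (fst ` set st) (rev st) = []" by (auto simp: kept_def filter_empty_conv)
  then show ?case using Nil
    by (intro exI[of _ "rev (map fst st)"])
      (auto simp: scan_Nil flush_result Dyck.empty simp del: funpow.simps)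
next
  case (Open i a w st D)
  then have "a \<in> T" by (auto simp: alphabet_def)
  have "E \<in> set_pmf (map_pmf fst (scan (Suc i) w ((i, Open a) # st) D))"
    using Open(2) by (simp only: scan_Open map_fst_ticks)
  moreover have "fst ` set st \<subseteq> {..<Suc i}" "i \<notin> fst ` set st" using Open(4) by auto
  ultimately obtain F where "E = F @ D" "distinct F"
    "set F \<subseteq> fst ` set ((i, Open a) # st) \<union> {Suc i..<Suc i + length w}"
    "kept (set F) (rev ((i, Open a) # st) @ List.enumerate (Suc i) w) \<in> Dyck T"
    using Open(1,3,5,6) \<open>a \<in> T\<close> by auto
  then show ?case by (intro exI[of _ F]) auto
next
  case (Close_Nil i a w D)
  have "E \<in> set_pmf (map_pmf fst (scan (Suc i) w [] (i # D)))"
    using Close_Nil(2) by (simp only: scan_Close_Nil map_fst_ticks)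
  from Close_Nil(1)[OF this] Close_Nil(3-) obtain F where
    F: "E = F @ i # D" "distinct F" "set F \<subseteq> {Suc i..<Suc i + length w}"
    "kept (set F) (List.enumerate (Suc i) w) \<in> Dyck T"
    by auto
  then have "kept (insert i (set F)) (List.enumerate (Suc i) w) \<in> Dyck T"
    by (subst kept_insert) (auto simp: fst_set_enumerate)
  then show ?case using F by (intro exI[of _ "F @ [i]"]) auto
next
  case (match i a w j st D)
  then have "a \<in> T" by (auto simp: alphabet_def)
  have "E \<in> set_pmf (map_pmf fst (scan (Suc i) w st D))"
    using match(2) by (simp only: scan_match map_fst_ticks)
  moreover have "fst ` set st \<subseteq> {..<Suc i}" using match(4) by auto
  ultimately obtain F where F: "E = F @ D" "distinct F"
    "set F \<subseteq> fst ` set st \<union> {Suc i..<Suc i + length w}"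
    "kept (set F) (rev st @ List.enumerate (Suc i) w) \<in> Dyck T"
    using match(1,3,5,6) by auto
  \<comment> \<open>Neither matched symbol is deleted later, so the pair can be inserted
    back.\<close>
  then have "i \<notin> set F" "j \<notin> set F" using match(3,4) by force+
  then show ?case using F \<open>a \<in> T\<close> by (intro exI[of _ F]) (auto simp: Dyck_insert_pair)
next
  case (mismatch i a w j x st D)
  from mismatch(4) consider
      (top) "E \<in> set_pmf (map_pmf fst (scan i (Close a # w) st (j # D)))"
    | (cur) "E \<in> set_pmf (map_pmf fst (scan (Suc i) w ((j, x) # st) (i # D)))"
    unfolding map_fst_scan_mismatch[OF mismatch(1)] by (auto split: if_splits)
  then show ?case
  proof cases
    case top
    then obtain F where F: "E = F @ j # D" "distinct F"
      "set F \<subseteq> fst ` set st \<union> {i..<i + length (Close a # w)}"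
      "kept (set F) (rev st @ List.enumerate i (Close a # w)) \<in> Dyck T"
      using mismatch(2)[OF top] mismatch(5-) by auto
    \<comment> \<open>\<open>j\<close> occurs nowhere in the rest, so adding it to the deleted set
      changes nothing there.\<close>
    have "j \<notin> fst ` set (rev st @ List.enumerate i (Close a # w))"
      using mismatch(5,6) by (auto simp: image_Un fst_set_enumerate simp del: enumerate_simps)
    then have "kept (insert j (set F)) (rev st @ List.enumerate i (Close a # w)) \<in> Dyck T"
      using F(4) by (simp only: kept_insert not_False_eq_True)
    moreover have "j \<notin> set F" using F(3) mismatch(5,6) by auto
    ultimately show ?thesis using F by (intro exI[of _ "F @ [j]"]) auto
  next
    case cur
    have "fst ` set ((j, x) # st) \<subseteq> {..<Suc i}" using mismatch(6) by auto
    then obtain F where F: "E = F @ i # D" "distinct F"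
      "set F \<subseteq> fst ` set ((j, x) # st) \<union> {Suc i..<Suc i + length w}"
      "kept (set F) (rev ((j, x) # st) @ List.enumerate (Suc i) w) \<in> Dyck T"
      using mismatch(3)[OF cur] mismatch(5,7,8) by auto
    have "i \<notin> fst ` set (rev ((j, x) # st) @ List.enumerate (Suc i) w)"
      using mismatch(6) by (auto simp: image_Un fst_set_enumerate)
    then have "kept (insert i (set F)) (rev ((j, x) # st) @ List.enumerate (Suc i) w) \<in> Dyck T"
      using F(4) by (simp only: kept_insert not_False_eq_True)
    moreover have "i \<notin> set F" using F(3) mismatch(6) by force
    ultimately show ?thesis using F by (intro exI[of _ "F @ [i]"]) auto
  qed
qed

section \<open>Time bound and approximation guarantee\<close>

lemma random_deletion_eq: "random_deletion \<sigma> = (tick ^^ 3) (scan 0 \<sigma> [] [])"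
  by (simp add: random_deletion_def charged_let_def eval_nat_numeral)

text \<open>The factor 26 is twice the rate 13 of the scan; the spare 26 absorbs the three setup
  operations and the constant 2.\<close>

lemma random_deletion_time:
  "\<forall>(D, t)\<in>set_pmf (random_deletion \<sigma>). t \<le> 26 * (length \<sigma> + 1)"
proof -
  have "\<forall>x\<in>set_pmf (random_deletion \<sigma>). snd x \<le> 26 * (length \<sigma> + 1)"
    using scan_time[of 0 \<sigma> "[]" "[]"] unfolding random_deletion_eq set_ticks by fastforce
  then show ?thesis by auto
qed

lemma random_deletion_correct:
  assumes "D \<in> set_pmf (map_pmf fst (random_deletion \<sigma>))" "\<sigma> \<in> lists (alphabet T)"
  shows "distinct D \<and> set D \<subseteq> {..<length \<sigma>} \<and> delete_positions (set D) \<sigma> \<in> Dyck T"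
proof -
  have "delete_positions (set D) \<sigma> = kept (set D) (List.enumerate 0 \<sigma>)"
    by (simp add: delete_positions_def kept_enumerate Compl_eq)
  then show ?thesis
    using scan_result_Dyck[of D 0 \<sigma> "[]" "[]" T] assms
    by (auto simp: random_deletion_eq simp del: funpow.simps)
qed

lemma random_deletion_approx:
  assumes "\<sigma> \<in> lists (alphabet T)"
  defines "d \<equiv> deletion_distance T \<sigma>"
  shows "1 / 4 \<le> measure_pmf.prob (random_deletion \<sigma>) {(D, t). deletion_approx T \<sigma> (2 * d) D}"
proof -
  let ?M = "map_pmf fst (random_deletion \<sigma>)"
  \<comment> \<open>The budget \<open>2 * d * d\<close> is the factor \<open>2 * d\<close> times the
    optimum \<open>d\<close>.\<close>
  have "1 / 4 \<le> hit d (2 * d * d)" by (rule hit_lower_bound)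
  also have "\<dots> \<le> measure_pmf.prob ?M {D. length D \<le> 2 * d * d}"
    using prob_few_deletions[of T d "[]" \<sigma> "2 * d * d" 0 "[]"] edit_deletion_distance[of T \<sigma>]
    by (simp add: d_def random_deletion_eq del: funpow.simps)
  \<comment> \<open>Every log in the support repairs the string, so a short log is already an
    approximation.\<close>
  also have "\<dots> \<le> measure_pmf.prob ?M {D. deletion_approx T \<sigma> (2 * d) D}"
    using random_deletion_correct[OF _ assms(1)]
    by (intro measure_pmf.finite_measure_mono_AE)
      (auto simp: AE_measure_pmf_iff deletion_approx_def d_def)
  also have "\<dots> = measure_pmf.prob (random_deletion \<sigma>) {(D, t). deletion_approx T \<sigma> (2 * d) D}"
    by (simp add: vimage_def case_prod_unfold)
  finally show ?thesis .
qed

theorem theorem5: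
  "\<exists>(p::real) (C::nat). p > 0 \<and>
     (\<forall>(T::'a set) (s::nat) (n::nat) (\<sigma>::'a paren list).
        finite T \<longrightarrow> card T = s \<longrightarrow> s \<ge> 2 \<longrightarrow> \<sigma> \<in> lists (alphabet T) \<longrightarrow> length \<sigma> = n \<longrightarrow>
        (\<forall>(D, t) \<in> set_pmf (random_deletion \<sigma>). t \<le> C * (n + 1)) \<and>
        measure_pmf.prob (random_deletion \<sigma>)
          {(D, t). deletion_approx T \<sigma> (2 * deletion_distance T \<sigma>) D} \<ge> p)"
  using random_deletion_time random_deletion_approx
  by (intro exI[of _ "1 / 4"] exI[of _ 26]) auto

end
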